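(* For every finite simple graph $G$ on $n$ vertices that has no isolated vertices and no isolated edges (i.e., no connected component isomorphic to $K_2$), $\gamma_{tg}(G) \leq \frac{3}{4}n$.
   Context: Let $G$ be a graph without isolated vertices. A vertex is totally dominated by a set $A\subseteq V(G)$ if it has a neighbor in $A$; a totally dominating set is a set totally dominating every vertex of $G$. In the total domination game on $G$, two players, Dominator and Staller, alternately select vertices of $G$, Dominator moving first. Each selected vertex must strictly increase the number of vertices totally dominated by the set of selected vertices. The game ends when the set of selected vertices is a totally dominating set of $G$. Dominator aims to minimize the number of selected vertices at the end, Staller aims to maximize it. The game total domination number $\gamma_{tg}(G)$ is the number of selected vertices at the end of the game when Dominator starts and both players play optimally. *)

theory Defs
  imports Complex_Main "Graph_Theory.Graph_Theory"
begin

text \<open>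
  A finite simple graph is a \<^const>\<open>graph\<close> in the sense of the Graph Theory library: a finite,
  symmetric digraph without loops and parallel arcs.  The neighbours of \<open>u\<close> are the \<open>v\<close> with
  \<open>u \<rightarrow>\<^bsub>G\<^esub> v\<close>, and, by symmetry, \<^const>\<open>pre_digraph.sccs\<close> is the set of connected components.
\<close>

definition isolated_vertex :: "('a,'b) pre_digraph \<Rightarrow> 'a \<Rightarrow> bool" where
  "isolated_vertex G v \<longleftrightarrow> v \<in> verts G \<and> \<not> (\<exists>u. v \<rightarrow>\<^bsub>G\<^esub> u)"

definition totally_dominated :: "('a,'b) pre_digraph \<Rightarrow> 'a set \<Rightarrow> 'a set" where
  "totally_dominated G A = {v \<in> verts G. \<exists>u\<in>A. v \<rightarrow>\<^bsub>G\<^esub> u}"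

definition totally_dominating_set :: "('a,'b) pre_digraph \<Rightarrow> 'a set \<Rightarrow> bool" where
  "totally_dominating_set G A \<longleftrightarrow> A \<subseteq> verts G \<and> totally_dominated G A = verts G"

definition legal_moves :: "('a,'b) pre_digraph \<Rightarrow> 'a set \<Rightarrow> 'a set" where
  "legal_moves G A =
    {v \<in> verts G. card (totally_dominated G A) < card (totally_dominated G (insert v A))}"

lemma totally_dominated_subset: "totally_dominated G A \<subseteq> verts G"
  by (auto simp: totally_dominated_def)

datatype player = Dominator | Staller

text \<open>
  \<open>game_value G p A\<close> is the number of selected vertices at the end of the game under optimal play,
  when the vertices in \<open>A\<close> have been selected so far and \<open>p\<close> is to move.  The finiteness test only
  serves termination.  If \<open>G\<close> has no isolated vertices, then Min and Max are always taken over
  nonempty sets, by lemma \<open>legal_moves_nonempty\<close> below.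
\<close>

function game_value :: "('a,'b) pre_digraph \<Rightarrow> player \<Rightarrow> 'a set \<Rightarrow> nat" where
  "game_value G p A =
    (if infinite (verts G) \<or> totally_dominating_set G A then card A
     else case p of
       Dominator \<Rightarrow> Min ((\<lambda>v. game_value G Staller (insert v A)) ` legal_moves G A)
     | Staller \<Rightarrow> Max ((\<lambda>v. game_value G Dominator (insert v A)) ` legal_moves G A))"
  by pat_completeness auto
termination
proof (relation "measure (\<lambda>(G, p, A). card (verts G) - card (totally_dominated G A))", goal_cases)
  case 1
  show ?case by simp
next
  case (2 G p A v)
  moreover have "card (totally_dominated G (insert v A)) \<le> card (verts G)"
    using 2 by (intro card_mono totally_dominated_subset) auto
  ultimately show ?case by (auto simp: legal_moves_def)
next
  case (3 G p A v)
  moreover have "card (totally_dominated G (insert v A)) \<le> card (verts G)"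
    using 3 by (intro card_mono totally_dominated_subset) auto
  ultimately show ?case by (auto simp: legal_moves_def)
qed

declare game_value.simps [simp del]

definition game_total_domination_number :: "('a,'b) pre_digraph \<Rightarrow> nat" ("\<gamma>\<^sub>t\<^sub>g") where
  "\<gamma>\<^sub>t\<^sub>g G = game_value G Dominator {}"

lemma legal_moves_nonempty:
  assumes "graph G" and "\<And>v. \<not> isolated_vertex G v"
    and "A \<subseteq> verts G" and "\<not> totally_dominating_set G A"
  shows "legal_moves G A \<noteq> {}"
proof -
  interpret graph G by fact
  obtain v where v: "v \<in> verts G" "v \<notin> totally_dominated G A"
    using assms(3,4) totally_dominated_subset[of G A]
    unfolding totally_dominating_set_def by auto
  then obtain u where u: "v \<rightarrow>\<^bsub>G\<^esub> u" using assms(2)[of v] by (auto simp: isolated_vertex_def)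
  have "v \<in> totally_dominated G (insert u A)"
    using v u by (auto simp: totally_dominated_def)
  moreover have "totally_dominated G A \<subseteq> totally_dominated G (insert u A)"
    by (auto simp: totally_dominated_def)
  moreover have "finite (totally_dominated G (insert u A))"
    using totally_dominated_subset finite_verts by (rule finite_subset)
  ultimately have "card (totally_dominated G A) < card (totally_dominated G (insert u A))"
    using v by (intro psubset_card_mono) auto
  then show ?thesis using adj_in_verts(2)[OF u] by (auto simp: legal_moves_def)
qed

end

theory Submission
  imports Defs
begin

text \<open>
  Let \<open>U\<close> be the set of vertices not yet totally dominated and measure a position by
  \<open>2 |live| + |U| + |supports| - |tight|\<close>, where the live vertices are the legal moves, the supports
  are the vertices with an undominated neighbour of degree one, and \<open>r \<in> U\<close> is tight if it has degree
  at least two and some neighbour for which \<open>r\<close> is the only undominated neighbour.  In a graph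
  without isolated edges every support is initially tight, so the potential starts at no more than
  three times the number of vertices; hence it suffices that it falls by at least 8 over a move of
  Dominator and Staller's reply.

  Every move lowers the potential by at least 2.  A move lowering it by exactly 2 is only possible
  next to a move lowering it by 6, so Dominator can take a move worth 6, or else one worth 5 after
  which Staller has no move worth 2, unless every legal move has only one undominated neighbour; in
  that case all moves are worth at least 4 for the rest of the game.
\<close>

section \<open>Lower bounds on cardinalities from listed elements\<close>

lemma card_ge_1: "x \<in> X \<Longrightarrow> finite X \<Longrightarrow> card X \<ge> 1"
  by (metis One_nat_def Suc_leI card_gt_0_iff empty_iff)

lemma card_ge_2: "x \<in> X \<Longrightarrow> y \<in> X \<Longrightarrow> x \<noteq> y \<Longrightarrow> finite X \<Longrightarrow> card X \<ge> 2"
  using card_mono[of X "{x, y}"] by simp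

lemma card_ge_3:
  "x \<in> X \<Longrightarrow> y \<in> X \<Longrightarrow> z \<in> X \<Longrightarrow> x \<noteq> y \<Longrightarrow> x \<noteq> z \<Longrightarrow> y \<noteq> z \<Longrightarrow> finite X \<Longrightarrow> card X \<ge> 3"
  using card_mono[of X "{x, y, z}"] by simp

section \<open>Neighbourhood systems and the potential\<close>

text \<open>Only neighbourhoods enter the potential, so arcs are abstracted to a symmetric map
  \<open>N\<close>. By symmetry any \<open>u\<close> with \<open>N u\<close> nonempty lies in
  \<open>V\<close>.\<close>

locale nbhds =
  fixes V :: "'a set" and N :: "'a \<Rightarrow> 'a set"
  assumes finite_V: "finite V"
    and N_subset: "N u \<subseteq> V"
    and N_sym: "v \<in> N u \<Longrightarrow> u \<in> N v"
    and N_nonempty: "v \<in> V \<Longrightarrow> N v \<noteq> {}"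
begin

definition pendant :: "'a \<Rightarrow> bool" where
  "pendant x \<longleftrightarrow> (\<exists>w. N x = {w})"

definition live :: "'a set \<Rightarrow> 'a set" where
  "live U = {u. N u \<inter> U \<noteq> {}}"

definition supports :: "'a set \<Rightarrow> 'a set" where
  "supports U = {u. \<exists>x \<in> N u \<inter> U. pendant x}"

definition tight :: "'a set \<Rightarrow> 'a set" where
  "tight U = {r \<in> U. \<not> pendant r \<and> (\<exists>w \<in> N r. N w \<inter> U = {r})}"

definition potential :: "'a set \<Rightarrow> int" where
  "potential U =
    2 * int (card (live U)) + int (card U) + int (card (supports U)) - int (card (tight U))"

definition decrease :: "'a set \<Rightarrow> 'a \<Rightarrow> int" where
  "decrease U u = potential U - potential (U - N u)"

text \<open>This set and the next two account for the effect of playing \<open>u\<close> on the live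
  vertices, the supports and the tight vertices.\<close>

definition lost_live :: "'a set \<Rightarrow> 'a \<Rightarrow> 'a set" where
  "lost_live U u = live U - live (U - N u)"

definition lost_supports :: "'a set \<Rightarrow> 'a \<Rightarrow> 'a set" where
  "lost_supports U u = supports U - supports (U - N u)"

definition new_tight :: "'a set \<Rightarrow> 'a \<Rightarrow> 'a set" where
  "new_tight U u = tight (U - N u) - tight U"

lemma finite_subset_V: "X \<subseteq> V \<Longrightarrow> finite X"
  using finite_V by (rule rev_finite_subset)

lemma N_V: "v \<in> N u \<Longrightarrow> u \<in> V" "v \<in> N u \<Longrightarrow> v \<in> V"
  using N_sym N_subset by blast+

lemma live_V: "live U \<subseteq> V"
  by (auto simp: live_def intro: N_V)

lemma supports_V: "supports U \<subseteq> V"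
  by (auto simp: supports_def intro: N_V)

lemma tight_V: "tight U \<subseteq> V"
  by (auto simp: tight_def intro: N_V)

lemma finites:
  "finite (live U)" "finite (supports U)" "finite (tight U)" "finite (N u)"
  "finite (lost_live U u)" "finite (lost_supports U u)" "finite (new_tight U u)"
  unfolding lost_live_def lost_supports_def new_tight_def
  using finite_subset_V[OF live_V] finite_subset_V[OF supports_V] finite_subset_V[OF tight_V]
    finite_subset_V[OF N_subset] by simp_all

lemma tight_persists: "tight U - N u \<subseteq> tight (U - N u)"
  by (auto simp: tight_def)

text \<open>
  All neighbours of an undominated vertex are still legal moves, so pendancy need not be taken
  relative to \<open>U\<close>; this is why supports are never created and tight vertices disappear only by
  being dominated.
\<close>

lemma decrease_eq:
  assumes "U \<subseteq> V"
  shows "decrease U u = 2 * int (card (lost_live U u)) + int (card (N u \<inter> U - tight U))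
    + int (card (lost_supports U u)) + int (card (new_tight U u))"
proof -
  have fU: "finite U" using assms by (rule finite_subset_V)
  have "live (U - N u) \<subseteq> live U" "supports (U - N u) \<subseteq> supports U"
    by (auto simp: live_def supports_def)
  then have 1: "int (card (lost_live U u)) = int (card (live U)) - int (card (live (U - N u)))"
    and 2: "int (card (lost_supports U u)) = int (card (supports U)) - int (card (supports (U - N u)))"
    unfolding lost_live_def lost_supports_def
    by (simp_all add: card_Diff_subset finites card_mono of_nat_diff)
  have 3: "card U = card (U - N u) + card (N u \<inter> U)"
    using fU by (metis Int_commute add.commute card_Int_Diff)
  have tU: "tight U \<subseteq> U" by (auto simp: tight_def)
  \<comment> \<open>A dominated tight vertex leaves both \<open>U\<close> and
    \<open>tight U\<close>, which enter the potential with opposite signs; only dominated vertices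
    that are not tight contribute.\<close>
  have 4: "card (N u \<inter> U) = card (N u \<inter> U - tight U) + card (tight U \<inter> N u)"
  proof -
    have "N u \<inter> U \<inter> tight U = tight U \<inter> N u" using tU by auto
    then show ?thesis using card_Int_Diff[of "N u \<inter> U" "tight U"] fU by simp
  qed
  have "tight (U - N u) \<inter> tight U = tight U - N u"
    using tight_persists by (auto simp: tight_def)
  then have 5: "card (tight (U - N u)) = card (tight U - N u) + card (new_tight U u)"
    unfolding new_tight_def using card_Int_Diff[of "tight (U - N u)" "tight U"] finites by simp
  have 6: "card (tight U) = card (tight U \<inter> N u) + card (tight U - N u)"
    using card_Int_Diff finites by blast
  show ?thesis unfolding decrease_def potential_def using 1 2 3 4 5 6 by linarith
qed

lemma self_lost: "N u \<inter> U \<noteq> {} \<Longrightarrow> u \<in> lost_live U u"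
  by (auto simp: lost_live_def live_def)

lemma leaf_lost: "r \<in> N u \<Longrightarrow> N w \<inter> U = {r} \<Longrightarrow> w \<in> lost_live U u"
  by (auto simp: lost_live_def live_def)

section \<open>Moves worth 2\<close>

lemma decrease_ge_2:
  assumes "U \<subseteq> V" "N u \<inter> U \<noteq> {}"
  shows "decrease U u \<ge> 2"
  using decrease_eq[OF assms(1), of u] card_ge_1[OF self_lost[OF assms(2)]] finites by simp

text \<open>The loss of \<open>u\<close> as a legal move already accounts for 2, so every other term
  of \<open>decrease_eq\<close> vanishes. The dominated \<open>r\<close> is therefore tight, and the
  move witnessing this is lost with \<open>u\<close>, hence is \<open>u\<close> itself.\<close>

lemma decrease_2E:
  assumes U: "U \<subseteq> V" and u: "N u \<inter> U \<noteq> {}" and d: "decrease U u \<le> 2"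
  obtains r where "N u \<inter> U = {r}" "r \<in> tight U" "new_tight U u = {}"
    "\<And>w. w \<in> N r \<Longrightarrow> N w \<inter> U = {r} \<Longrightarrow> w = u"
proof -
  have g1: "card (lost_live U u) \<ge> 1" using card_ge_1[OF self_lost[OF u]] finites by simp
  note e = decrease_eq[OF U, of u]
  have "card (N u \<inter> U - tight U) = 0" using e d g1 by linarith
  then have t: "N u \<inter> U \<subseteq> tight U" using finites by simp
  have "card (new_tight U u) = 0" using e d g1 by linarith
  then have n: "new_tight U u = {}" using finites by simp
  have l: "w = u" if "w \<in> lost_live U u" for w
  proof (rule ccontr)
    assume "w \<noteq> u"
    then have "card (lost_live U u) \<ge> 2" using card_ge_2[OF that self_lost[OF u]] finites by blast
    then show False using e d by linarith
  qed
  obtain r where r: "r \<in> N u \<inter> U" using u by auto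
  then have rt: "r \<in> tight U" using t by auto
  then obtain w where "w \<in> N r" "N w \<inter> U = {r}" by (auto simp: tight_def)
  moreover from this have "w = u" using l leaf_lost r by blast
  ultimately have "N u \<inter> U = {r}" by simp
  then show thesis using that rt n l leaf_lost by blast
qed

text \<open>If \<open>v\<close> made nothing tight, \<open>r\<close> was tight before
  \<open>v\<close> with \<open>u\<close> as its witness. A second neighbour \<open>w\<close> of
  \<open>r\<close> would then be worth 6 before \<open>v\<close>, unless it sees just one further
  vertex \<open>y\<close>, which the moves \<open>v\<close> and \<open>u\<close> would make
  tight.\<close>

lemma decrease_2_then_new_tight:
  assumes U: "U \<subseteq> V" and max5: "\<And>w. N w \<inter> U \<noteq> {} \<Longrightarrow> decrease U w \<le> 5"
    and u: "N u \<inter> (U - N v) \<noteq> {}" and d: "decrease (U - N v) u \<le> 2"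
  shows "new_tight U v \<noteq> {}"
proof
  assume none: "new_tight U v = {}"
  let ?U = "U - N v"
  have U': "?U \<subseteq> V" using U by auto
  obtain r where r: "N u \<inter> ?U = {r}" "r \<in> tight ?U" "new_tight ?U u = {}"
    and only: "\<And>w. w \<in> N r \<Longrightarrow> N w \<inter> ?U = {r} \<Longrightarrow> w = u"
    using decrease_2E[OF U' u d] by blast
  have rt: "r \<in> tight U" using none r(2) by (auto simp: new_tight_def)
  then obtain l where l: "l \<in> N r" "N l \<inter> U = {r}" by (auto simp: tight_def)
  moreover have "N l \<inter> ?U = {r}" using l r(1) by auto
  ultimately have ul: "N u \<inter> U = {r}" using only by blast
  have "u \<in> N r" using r(1) N_sym by auto
  moreover have "\<not> pendant r" using rt by (simp add: tight_def)
  ultimately obtain w where w: "w \<in> N r" "w \<noteq> u"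
    unfolding pendant_def by blast
  have rw: "r \<in> N w \<inter> ?U" using w N_sym r(1) by auto
  with only[OF w(1)] w(2) obtain y where y: "y \<in> N w \<inter> ?U" "y \<noteq> r" by blast
  \<comment> \<open>Playing \<open>w\<close> in \<open>U\<close> loses both \<open>w\<close> and
    \<open>u\<close>, worth 4, so at most 1 is left for all other terms. A tight vertex besides
    \<open>r\<close> would cost a third lost move; \<open>y\<close>, not being tight, uses up the 1
    and excludes further vertices and lost supports.\<close>
  have legal: "N w \<inter> U \<noteq> {}" using rw by auto
  have le5: "decrease U w \<le> 5" using max5[OF legal] .
  note e = decrease_eq[OF U, of w]
  have wl: "w \<in> lost_live U w" using self_lost[OF legal] .
  have ull: "u \<in> lost_live U w" using leaf_lost[OF _ ul] rw by auto
  have g2: "card (lost_live U w) \<ge> 2" using card_ge_2[OF wl ull w(2)] finites by blast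
  have nt: "z \<notin> tight U" if z: "z \<in> N w \<inter> U" "z \<noteq> r" for z
  proof
    assume "z \<in> tight U"
    then obtain k where k: "N k \<inter> U = {z}" by (auto simp: tight_def)
    have "k \<in> lost_live U w" using leaf_lost[OF _ k] z by auto
    moreover have "k \<noteq> u" using k ul z(2) by auto
    moreover have "k \<noteq> w" using k rw z(2) by auto
    ultimately have "card (lost_live U w) \<ge> 3"
      using card_ge_3[OF wl ull _ w(2)] finites by blast
    then show False using e le5 by linarith
  qed
  have yt: "y \<in> N w \<inter> U - tight U" using y nt by auto
  have g1: "card (N w \<inter> U - tight U) \<ge> 1" using card_ge_1[OF yt] finites by blast
  have two: "N w \<inter> U = {r, y}"
  proof (rule ccontr)
    assume "N w \<inter> U \<noteq> {r, y}"
    then obtain z where "z \<in> N w \<inter> U" "z \<noteq> r" "z \<noteq> y" using rw y by blast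
    then have "card (N w \<inter> U - tight U) \<ge> 2"
      using card_ge_2[OF yt, of z] nt finites by blast
    then show False using e le5 g2 by linarith
  qed
  have "\<not> pendant y"
  proof
    assume p: "pendant y"
    have "w \<in> lost_supports U w" using p y by (auto simp: lost_supports_def supports_def)
    from card_ge_1[OF this] have "card (lost_supports U w) \<ge> 1" using finites by blast
    then show False using e le5 g2 g1 by linarith
  qed
  moreover have "y \<notin> N u" using r(1) y by auto
  moreover have "r \<in> N u" using r(1) by auto
  \<comment> \<open>After \<open>v\<close> and \<open>u\<close>, the only undominated neighbour of
    \<open>w\<close> is \<open>y\<close>.\<close>
  ultimately have "y \<in> tight (?U - N u)"
    using y two w N_sym[of y w] by (auto simp: tight_def)
  then have "y \<in> tight ?U" using r(3) by (auto simp: new_tight_def)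
  then have "y \<in> tight U" using none by (auto simp: new_tight_def)
  then show False using nt y by auto
qed

section \<open>Dominator's choice of a move\<close>

text \<open>Each tight vertex dominated by \<open>w\<close> has a witness seeing it alone. These
  witnesses are distinct, differ from \<open>w\<close> and are lost with it, so a dominated tight
  vertex contributes 2 and any other dominated vertex 1.\<close>

lemma decrease_nonleaf:
  assumes U: "U \<subseteq> V" and w: "card (N w \<inter> U) \<ge> 2"
  shows "decrease U w \<ge> 2 + int (card (N w \<inter> U)) + int (card (N w \<inter> U \<inter> tight U))
    + int (card (lost_supports U w)) + int (card (new_tight U w))"
proof -
  let ?T = "N w \<inter> U \<inter> tight U"
  have "\<forall>r \<in> ?T. \<exists>l. N l \<inter> U = {r}" by (auto simp: tight_def)
  then obtain leaf where leaf: "\<And>r. r \<in> ?T \<Longrightarrow> N (leaf r) \<inter> U = {r}" by metis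
  have "inj_on leaf ?T"
    by (rule inj_onI) (metis leaf singleton_inject)
  then have c: "card (leaf ` ?T) = card ?T" by (rule card_image)
  have "w \<notin> leaf ` ?T"
  proof
    assume "w \<in> leaf ` ?T"
    then obtain r where "N w \<inter> U = {r}" using leaf by blast
    then show False using w by simp
  qed
  then have "card (insert w (leaf ` ?T)) = Suc (card ?T)"
    using c finites by simp
  moreover have "N w \<inter> U \<noteq> {}" using w by auto
  then have "w \<in> lost_live U w" by (rule self_lost)
  moreover have "leaf r \<in> lost_live U w" if "r \<in> ?T" for r
    using that leaf_lost[OF _ leaf[OF that]] by blast
  ultimately have "Suc (card ?T) \<le> card (lost_live U w)"
    using card_mono[of "lost_live U w" "insert w (leaf ` ?T)"] finites(5)[of U w] by auto
  moreover have "card (N w \<inter> U) = card ?T + card (N w \<inter> U - tight U)"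
    using card_Int_Diff[of "N w \<inter> U" "tight U"] finites by simp
  ultimately show ?thesis using decrease_eq[OF U, of w] by linarith
qed

text \<open>The bound 4 on the move alone serves the case in which it ends the game. The choice is a
  move worth 6, or one worth 5 making nothing tight; failing both, the structure of the remaining
  positions is worked out.\<close>

lemma dominator_move:
  assumes U: "U \<subseteq> V" and ne: "U \<noteq> {}"
  shows "\<exists>v. N v \<inter> U \<noteq> {} \<and> decrease U v \<ge> 4 \<and>
    (\<forall>u. N u \<inter> (U - N v) \<noteq> {} \<longrightarrow> decrease U v + decrease (U - N v) u \<ge> 8)"
proof (cases "\<exists>v. N v \<inter> U \<noteq> {} \<and> decrease U v \<ge> 6")
  case True
  then obtain v where v: "N v \<inter> U \<noteq> {}" "decrease U v \<ge> 6" by blast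
  have "decrease U v + decrease (U - N v) u \<ge> 8" if "N u \<inter> (U - N v) \<noteq> {}" for u
    using decrease_ge_2[of "U - N v" u] that U v by force
  then show ?thesis using v by (intro exI[of _ v]) auto
next
  case False
  then have max5: "decrease U w \<le> 5" if "N w \<inter> U \<noteq> {}" for w using that by force
  show ?thesis
  proof (cases "\<exists>v. N v \<inter> U \<noteq> {} \<and> decrease U v = 5 \<and> new_tight U v = {}")
    case True
    then obtain v where v: "N v \<inter> U \<noteq> {}" "decrease U v = 5" "new_tight U v = {}" by blast
    have "decrease (U - N v) u \<ge> 3" if "N u \<inter> (U - N v) \<noteq> {}" for u
      using decrease_2_then_new_tight[OF U max5 that] v by force
    then show ?thesis using v by (intro exI[of _ v]) auto
  next
    case no5: False
    have new5: "card (new_tight U w) \<ge> 1" if "N w \<inter> U \<noteq> {}" "decrease U w \<ge> 5" for w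
    proof -
      have "decrease U w = 5" using that max5[of w] by linarith
      then have "new_tight U w \<noteq> {}" using no5 that by blast
      then obtain z where "z \<in> new_tight U w" by blast
      from card_ge_1[OF this] show ?thesis using finites by blast
    qed
    \<comment> \<open>A third vertex, a tight vertex or a lost support would each raise the bound of
      \<open>decrease_nonleaf\<close> from 4 to 5; \<open>new5\<close> then supplies a new tight
      vertex, giving the forbidden 6.\<close>
    have edge: "\<exists>x y. x \<noteq> y \<and> N w \<inter> U = {x, y}"
      and edge_tight: "N w \<inter> U \<inter> tight U = {}"
      and edge_pendant: "\<And>z. z \<in> N w \<inter> U \<Longrightarrow> \<not> pendant z"
      and edge_lost: "lost_live U w = {w}"
      and edge_new: "card (new_tight U w) \<le> 1"
      if w: "card (N w \<inter> U) \<ge> 2" for w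
    proof -
      have legal: "N w \<inter> U \<noteq> {}" using w by auto
      note le = max5[OF legal] and n5 = new5[OF legal] and b = decrease_nonleaf[OF U w]
      have c2: "card (N w \<inter> U) = 2" using le n5 b w by linarith
      then show "\<exists>x y. x \<noteq> y \<and> N w \<inter> U = {x, y}" by (metis card_2_iff)
      have "card (N w \<inter> U \<inter> tight U) = 0" using le n5 b w by linarith
      then show t: "N w \<inter> U \<inter> tight U = {}" using finites by simp
      have "card (lost_supports U w) = 0" using le n5 b w by linarith
      then have "lost_supports U w = {}" using finites by simp
      moreover have "w \<in> lost_supports U w" if "z \<in> N w \<inter> U" "pendant z" for z
        using that by (auto simp: lost_supports_def supports_def)
      ultimately show "\<And>z. z \<in> N w \<inter> U \<Longrightarrow> \<not> pendant z" by blast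
      show "card (new_tight U w) \<le> 1" using le b w by linarith
      \<comment> \<open>Both dominated vertices contribute 1, so a second lost move would give 4 +
        2.\<close>
      have "N w \<inter> U - tight U = N w \<inter> U" using t by auto
      then have "card (lost_live U w) < 2" using decrease_eq[OF U, of w] c2 le by simp
      then have "z = w" if "z \<in> lost_live U w" for z
        using card_ge_2[OF that self_lost[OF legal]] finites(5)[of U w] by linarith
      then show "lost_live U w = {w}" using self_lost[OF legal] by blast
    qed
    txt \<open>
      Now every legal move \<open>w\<close> that is not a leaf has exactly two undominated neighbours; regarding
      these moves as the edges of a graph on \<open>U\<close>, its nontrivial components are triangles.
    \<close>
    show ?thesis
    proof (cases "\<exists>w. card (N w \<inter> U) \<ge> 2")
      case False
      \<comment> \<open>Having at most one undominated neighbour is inherited by every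
        \<open>W \<subseteq> U\<close>, so the bound \<open>ge4\<close> applies to Staller's reply
        too.\<close>
      then have leaf: "\<exists>r. N w \<inter> W = {r}" if "N w \<inter> W \<noteq> {}" "W \<subseteq> U" for w W
      proof -
        have "card (N w \<inter> W) \<le> card (N w \<inter> U)"
          using that finites by (intro card_mono) auto
        moreover have "\<not> card (N w \<inter> U) \<ge> 2" using False by blast
        moreover have "card (N w \<inter> W) > 0" using that finites by (simp add: card_gt_0_iff)
        ultimately have "card (N w \<inter> W) = 1" by linarith
        then show ?thesis by (rule card_1_singletonE) blast
      qed
      have ge4: "decrease W u \<ge> 4" if u: "N u \<inter> W \<noteq> {}" and W: "W \<subseteq> U" for u W
      proof -
        have WV: "W \<subseteq> V" using W U by simp
        obtain r where r: "N u \<inter> W = {r}" using leaf[OF u W] by blast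
        have ur: "u \<in> N r" using r N_sym by auto
        have ul: "u \<in> lost_live W u" using self_lost[OF u] .
        show ?thesis
        \<comment> \<open>A pendant \<open>r\<close> is never tight, and \<open>u\<close> stops
          being a support: 2 + 1 + 1. Otherwise a second neighbour of \<open>r\<close> also sees
          only \<open>r\<close>, so two moves are lost: 2 * 2.\<close>
        proof (cases "pendant r")
          case True
          then have "u \<in> lost_supports W u" using r by (auto simp: lost_supports_def supports_def)
          from card_ge_1[OF this] have "card (lost_supports W u) \<ge> 1" using finites by blast
          moreover have "r \<in> N u \<inter> W - tight W" using True r by (auto simp: tight_def)
          from card_ge_1[OF this] have "card (N u \<inter> W - tight W) \<ge> 1" using finites by blast
          moreover have "card (lost_live W u) \<ge> 1" using card_ge_1[OF ul] finites by blast
          ultimately show ?thesis using decrease_eq[OF WV, of u] by linarith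
        next
          case False
          then obtain w where w: "w \<in> N r" "w \<noteq> u" using ur unfolding pendant_def by blast
          then have "r \<in> N w \<inter> W" using N_sym r by auto
          then have "N w \<inter> W = {r}" using leaf[of w W] W by (metis empty_iff singletonD)
          then have "w \<in> lost_live W u" using leaf_lost r by blast
          then have "card (lost_live W u) \<ge> 2" using card_ge_2[OF ul] w finites by blast
          then show ?thesis using decrease_eq[OF WV, of u] by linarith
        qed
      qed
      obtain x v where "x \<in> U" "v \<in> N x" using ne N_nonempty U by blast
      then have v: "N v \<inter> U \<noteq> {}" using N_sym by blast
      have "decrease U v \<ge> 4" using ge4[OF v] by simp
      moreover have "decrease (U - N v) u \<ge> 4" if "N u \<inter> (U - N v) \<noteq> {}" for u
        using ge4[OF that] by simp
      ultimately show ?thesis using v by (intro exI[of _ v]) force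
    next
      case True
      then obtain w where w: "card (N w \<inter> U) \<ge> 2" by blast
      have nonleaf: "card (N k \<inter> U) \<ge> 2" if "a \<in> N k \<inter> U" "b \<in> N k \<inter> U" "a \<noteq> b" for a b k
        using card_ge_2[OF that] finites by blast
      \<comment> \<open>Dominating one end \<open>x\<close> of an edge \<open>k\<close> leaves
        \<open>k\<close> as a witness that the other end \<open>z\<close> is tight.\<close>
      have new: "z \<in> new_tight U v" if v: "x \<in> N v \<inter> U" and k: "N k \<inter> U = {x, z}" "x \<noteq> z" "z \<notin> N v"
        for v k x z
      proof -
        have k2: "card (N k \<inter> U) \<ge> 2" using k by simp
        have "z \<in> N k" using k by auto
        moreover have "z \<notin> tight U" using edge_tight[OF k2] k by auto
        moreover have "\<not> pendant z" using edge_pendant[OF k2] k by auto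
        moreover have "N k \<inter> (U - N v) = {z}" using k v by auto
        ultimately show ?thesis using N_sym[of z k] k unfolding new_tight_def tight_def by blast
      qed
      \<comment> \<open>As \<open>x\<close> is neither pendant nor tight, another edge
        \<open>k\<close> passes through it. It is not parallel to \<open>v\<close>, since playing
        \<open>v\<close> would then lose \<open>k\<close> as well.\<close>
      have other: "\<exists>k z. k \<noteq> v \<and> N k \<inter> U = {x, z} \<and> x \<noteq> z \<and> z \<notin> N v"
        if v: "card (N v \<inter> U) \<ge> 2" and x: "x \<in> N v \<inter> U" for v x
      proof -
        have np: "\<not> pendant x" using edge_pendant[OF v x] .
        have "v \<in> N x" using x N_sym by auto
        then obtain k where k: "k \<in> N x" "k \<noteq> v" using np unfolding pendant_def by blast
        have xk: "x \<in> N k \<inter> U" using k x N_sym by auto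
        have "x \<notin> tight U" using edge_tight[OF v] x by auto
        then have "N k \<inter> U \<noteq> {x}" using k x np by (auto simp: tight_def)
        then obtain z' where "z' \<in> N k \<inter> U" "z' \<noteq> x" using xk by blast
        then have k2: "card (N k \<inter> U) \<ge> 2" using nonleaf xk by blast
        obtain z where z: "N k \<inter> U = {x, z}" "x \<noteq> z"
          using edge[OF k2] xk by (metis doubleton_eq_iff insertE singletonD)
        have "z \<notin> N v"
        proof
          assume "z \<in> N v"
          then have "k \<in> lost_live U v" using z x by (auto simp: lost_live_def live_def)
          then show False using edge_lost[OF v] k by auto
        qed
        then show ?thesis using k z by blast
      qed
      have new1: "a = b" if "card (N v \<inter> U) \<ge> 2" "a \<in> new_tight U v" "b \<in> new_tight U v" for v a b
        using edge_new[OF that(1)] card_ge_2[OF that(2,3)] finites by fastforce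
      obtain x y where xy: "N w \<inter> U = {x, y}" "x \<noteq> y" using edge[OF w] by blast
      obtain w1 z where w1: "w1 \<noteq> w" "N w1 \<inter> U = {x, z}" "x \<noteq> z" "z \<notin> N w"
        using other[OF w, of x] xy by blast
      have w1_2: "card (N w1 \<inter> U) \<ge> 2" using w1 by simp
      have zn: "z \<in> new_tight U w" using new[of x w w1 z] xy w1 by blast
      \<comment> \<open>Any edge \<open>w\<close> serves as Dominator's move: 2 for the move, 2 for
        its ends and 1 for the new tight vertex \<open>z\<close>.\<close>
      have d5: "decrease U w \<ge> 5"
        using decrease_nonleaf[OF U w] w card_ge_1[OF zn] finites by force
      have "decrease (U - N w) u \<ge> 3" if u: "N u \<inter> (U - N w) \<noteq> {}" for u
      proof (rule ccontr)
        assume "\<not> ?thesis"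
        then have d: "decrease (U - N w) u \<le> 2" by simp
        have U': "U - N w \<subseteq> V" using U by auto
        obtain r where r: "N u \<inter> (U - N w) = {r}" "r \<in> tight (U - N w)"
            "new_tight (U - N w) u = {}"
          and only: "\<And>k. k \<in> N r \<Longrightarrow> N k \<inter> (U - N w) = {r} \<Longrightarrow> k = u"
          using decrease_2E[OF U' u d] by blast
        have "\<not> pendant r" using r(2) by (auto simp: tight_def)
        moreover have "u \<in> N r" using r(1) N_sym by auto
        ultimately obtain k where k: "k \<in> N r" "k \<noteq> u" unfolding pendant_def by blast
        have rk: "r \<in> N k \<inter> (U - N w)" using r(1) k N_sym by auto
        then obtain q where q: "q \<in> N k \<inter> (U - N w)" "q \<noteq> r" using only[OF k(1)] k(2) by blast
        have k2: "card (N k \<inter> U) \<ge> 2" using nonleaf[of r k q] rk q by blast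
        obtain a b where ab: "N k \<inter> U = {a, b}" using edge[OF k2] by blast
        have "r \<in> {a, b}" "q \<in> {a, b}" using rk q unfolding ab[symmetric] by auto
        then have kq: "N k \<inter> U = {r, q}" unfolding ab using q(2) by auto
        have "r \<notin> tight U" using edge_tight[OF k2] rk by auto
        then have "r \<in> new_tight U w" using r(2) by (simp add: new_tight_def)
        \<comment> \<open>A reply worth 2 must dominate the single vertex made tight by
          \<open>w\<close>.\<close>
        then have rz: "r = z" using new1[OF w zn] by simp
        \<comment> \<open>Now consider playing \<open>w1\<close>, with ends \<open>x\<close> and
          \<open>z\<close>, in \<open>U\<close> instead. It makes \<open>y\<close> tight through
          \<open>w\<close> and \<open>q\<close> tight through \<open>k\<close>; uniqueness forces
          \<open>q = y\<close>, but \<open>w\<close> dominates \<open>y\<close> and not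
          \<open>q\<close>.\<close>
        have "y \<notin> {x, z}" using xy w1 by auto
        then have "y \<notin> N w1" using w1(2) xy by auto
        then have "y \<in> new_tight U w1" using new[of x w1 w y] xy w1(2) by auto
        moreover have "q \<notin> {x, z}" using q xy rz by auto
        then have "q \<notin> N w1" using w1(2) q by auto
        then have "q \<in> new_tight U w1" using new[of z w1 k q] kq w1(2) rz q by auto
        ultimately have "q = y" using new1[OF w1_2] by simp
        then show False using q xy by auto
      qed
      then show ?thesis using w d5 by (intro exI[of _ w]) force
    qed
  qed
qed

section \<open>The initial potential and isolated edges\<close>

text \<open>A pendant neighbour of a support witnesses that the support is tight; the support is not
  itself pendant because there is no isolated edge. So the last two terms of the potential sum to at
  most 0.\<close>

lemma potential_V:
  assumes "\<And>x w. N x = {w} \<Longrightarrow> N w \<noteq> {x}"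
  shows "potential V \<le> 3 * int (card V)"
proof -
  have "supports V \<subseteq> tight V"
  proof
    fix u assume "u \<in> supports V"
    then obtain x where x: "x \<in> N u" "pendant x" by (auto simp: supports_def)
    have ux: "u \<in> N x" using x N_sym by auto
    then have Nx: "N x = {u}" using x(2) by (auto simp: pendant_def)
    have "\<not> pendant u"
      using assms[OF Nx] x(1) by (auto simp: pendant_def)
    moreover have "N x \<inter> V = {u}" using Nx N_V(2)[OF ux] by auto
    ultimately show "u \<in> tight V" using x N_V by (auto simp: tight_def)
  qed
  then have "card (supports V) \<le> card (tight V)" using finites card_mono by blast
  moreover have "card (live V) \<le> card V" using live_V finite_V card_mono by blast
  ultimately show ?thesis unfolding potential_def by linarith
qed

end

text \<open>Nothing but \<open>x\<close> and \<open>w\<close> is reachable from \<open>x\<close>,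
  and the subgraph induced on a reachable set is a component.\<close>

lemma (in graph) isolated_edge_in_sccs:
  assumes x: "{v. x \<rightarrow> v} = {w}" and w: "{v. w \<rightarrow> v} = {x}"
  shows "\<exists>C \<in> sccs. complete_digraph 2 C"
proof -
  have xw: "x \<rightarrow> w" "w \<rightarrow> x" using x w by blast+
  have ne: "x \<noteq> w" using xw adj_not_same by blast
  have inV: "x \<in> verts G" "w \<in> verts G" using xw by auto
  have "v \<in> {x, w}" if "x \<rightarrow>\<^sup>* v" for v
    using that
  proof (induct rule: reachable_induct)
    case base
    then show ?case by simp
  next
    case (step v z)
    then show ?case using x w by blast
  qed
  then have reach: "{v. x \<rightarrow>\<^sup>* v} = {x, w}"
    using xw inV by (auto intro: reachable_adjI)
  let ?C = "G \<restriction> {x, w}"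
  have "?C \<in> sccs" using induce_reachable_is_in_sccs[OF inV(1)] reach by simp
  moreover have "complete_digraph 2 ?C"
  proof -
    have ind: "induced_subgraph ?C G" using inV by (intro induced_induce) auto
    interpret C: digraph ?C using ind by (rule digraphI_induced)
    interpret S: sym_digraph ?C using ind by (rule induced_graph_imp_graph)
    have "graph ?C" by unfold_locales
    moreover have "arcs_ends ?C = {(x, w), (w, x)}"
    proof
      show "arcs_ends ?C \<subseteq> {(x, w), (w, x)}"
        using C.adj_in_verts C.adj_not_same by fastforce
      show "{(x, w), (w, x)} \<subseteq> arcs_ends ?C"
        using xw by (auto simp: arcs_ends_conv)
    qed
    ultimately show ?thesis using ne by (auto simp: complete_digraph_def)
  qed
  ultimately show ?thesis by blast
qed

section \<open>Transfer to the game\<close>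

locale isolate_free_graph = graph G for G :: "('a,'b) pre_digraph" (structure) +
  assumes isolate_free: "\<not> isolated_vertex G v"
begin

sublocale nbhds "verts G" "\<lambda>u. {v. u \<rightarrow> v}"
proof
  show "{v. u \<rightarrow> v} \<subseteq> verts G" for u by auto
  show "u \<in> {w. v \<rightarrow> w}" if "v \<in> {w. u \<rightarrow> w}" for u v
    using that sym_arcs by (auto simp: symmetric_def dest: symD)
  show "{w. v \<rightarrow> w} \<noteq> {}" if "v \<in> verts G" for v
    using isolate_free[of v] that by (auto simp: isolated_vertex_def)
qed simp

definition undominated :: "'a set \<Rightarrow> 'a set" where
  "undominated A = verts G - totally_dominated G A"

lemma undominated_insert: "undominated (insert v A) = undominated A - {w. v \<rightarrow> w}"
  using N_sym by (auto simp: undominated_def totally_dominated_def)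

lemma legal_moves_iff: "v \<in> legal_moves G A \<longleftrightarrow> {w. v \<rightarrow> w} \<inter> undominated A \<noteq> {}"
proof -
  have c: "card (totally_dominated G B) + card (undominated B) = card (verts G)" for B
    unfolding undominated_def
    using card_Diff_subset[of "totally_dominated G B" "verts G"] totally_dominated_subset[of G B]
      card_mono[OF finite_verts totally_dominated_subset[of G B]]
    by (simp add: finite_subset[OF totally_dominated_subset finite_verts])
  have fin: "finite (undominated A)" by (simp add: undominated_def)
  have "card (totally_dominated G A) < card (totally_dominated G (insert v A)) \<longleftrightarrow>
      card (undominated A - {w. v \<rightarrow> w}) < card (undominated A)"
    using c[of A] c[of "insert v A"] by (simp add: undominated_insert) linarith
  also have "\<dots> \<longleftrightarrow> {w. v \<rightarrow> w} \<inter> undominated A \<noteq> {}"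
  proof
    assume "card (undominated A - {w. v \<rightarrow> w}) < card (undominated A)"
    then show "{w. v \<rightarrow> w} \<inter> undominated A \<noteq> {}"
      by (metis Diff_triv inf_commute less_irrefl)
  next
    assume "{w. v \<rightarrow> w} \<inter> undominated A \<noteq> {}"
    then show "card (undominated A - {w. v \<rightarrow> w}) < card (undominated A)"
      using fin by (intro psubset_card_mono) auto
  qed
  finally show ?thesis by (auto simp: legal_moves_def)
qed

lemma totally_dominating_iff:
  "A \<subseteq> verts G \<Longrightarrow> totally_dominating_set G A \<longleftrightarrow> undominated A = {}"
  using totally_dominated_subset[of G A] by (auto simp: totally_dominating_set_def undominated_def)

lemma finite_legal_moves: "finite (legal_moves G A)"
  by (simp add: legal_moves_def)

lemma game_value_finished:
  "A \<subseteq> verts G \<Longrightarrow> undominated A = {} \<Longrightarrow> game_value G p A = card A"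
  by (simp add: game_value.simps[of G p A] totally_dominating_iff)

lemma game_value_Dominator_le:
  assumes "A \<subseteq> verts G" "undominated A \<noteq> {}" "v \<in> legal_moves G A"
  shows "game_value G Dominator A \<le> game_value G Staller (insert v A)"
proof -
  let ?S = "(\<lambda>v. game_value G Staller (insert v A)) ` legal_moves G A"
  have "game_value G Dominator A = Min ?S"
    using assms by (simp add: game_value.simps[of G Dominator A] totally_dominating_iff)
  moreover have "Min ?S \<le> game_value G Staller (insert v A)"
    using assms(3) finite_legal_moves by (intro Min_le) auto
  ultimately show ?thesis by simp
qed

lemma game_value_Staller_attained:
  assumes "A \<subseteq> verts G" "undominated A \<noteq> {}"
  obtains u where "u \<in> legal_moves G A"
    "game_value G Staller A = game_value G Dominator (insert u A)"
proof -
  let ?S = "(\<lambda>u. game_value G Dominator (insert u A)) ` legal_moves G A"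
  have "legal_moves G A \<noteq> {}"
    using assms legal_moves_nonempty[OF graph_axioms isolate_free]
    by (simp add: totally_dominating_iff)
  then have "Max ?S \<in> ?S" using finite_legal_moves by (intro Max_in) auto
  moreover have "game_value G Staller A = Max ?S"
    using assms by (simp add: game_value.simps[of G Staller A] totally_dominating_iff)
  ultimately show thesis using that by auto
qed

text \<open>Induction over rounds: two moves raise \<open>4 * card A\<close> by at most 8, which the
  drop of the potential pays for.\<close>

lemma game_value_le_potential:
  assumes "A \<subseteq> verts G"
  shows "4 * int (game_value G Dominator A) \<le> 4 * int (card A) + potential (undominated A)"
  using assms
proof (induction "card (undominated A)" arbitrary: A rule: less_induct)
  case less
  have card_insert: "card (insert a B) \<le> card B + 1" for a and B :: "'a set"
    by (cases "finite B") (auto simp: card_insert_if)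
  have pot_empty: "potential {} = 0"
    by (simp add: potential_def live_def supports_def tight_def)
  show ?case
  proof (cases "undominated A = {}")
    case True
    then show ?thesis using less.prems by (simp add: game_value_finished pot_empty)
  next
    case False
    let ?U = "undominated A"
    have "?U \<subseteq> verts G" by (auto simp: undominated_def)
    from dominator_move[OF this False] obtain v where
      v: "{w. v \<rightarrow> w} \<inter> ?U \<noteq> {}" "decrease ?U v \<ge> 4"
      and reply: "\<And>u. {w. u \<rightarrow> w} \<inter> (?U - {w. v \<rightarrow> w}) \<noteq> {} \<Longrightarrow>
        decrease ?U v + decrease (?U - {w. v \<rightarrow> w}) u \<ge> 8"
      by blast
    have legal: "v \<in> legal_moves G A" using v(1) by (simp add: legal_moves_iff)
    have A1: "insert v A \<subseteq> verts G" using legal less.prems by (auto simp: legal_moves_def)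
    have dv: "decrease ?U v = potential ?U - potential (undominated (insert v A))"
      by (simp add: decrease_def undominated_insert)
    have le: "game_value G Dominator A \<le> game_value G Staller (insert v A)"
      using less.prems False legal by (rule game_value_Dominator_le)
    show ?thesis
    proof (cases "undominated (insert v A) = {}")
      case True
      then have "game_value G Staller (insert v A) = card (insert v A)"
        using A1 by (simp add: game_value_finished)
      \<comment> \<open>The game ends on Dominator's move, so this single move must be paid for by
        its own drop of 4.\<close>
      moreover have "potential ?U \<ge> 4" using v(2) dv by (simp add: True pot_empty)
      ultimately show ?thesis using le card_insert[of v A] by linarith
    next
      case False
      then obtain u where u: "u \<in> legal_moves G (insert v A)"
        "game_value G Staller (insert v A) = game_value G Dominator (insert u (insert v A))"
        using game_value_Staller_attained[OF A1] by blast
      let ?A = "insert u (insert v A)"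
      have A2: "?A \<subseteq> verts G" using u(1) A1 by (auto simp: legal_moves_def)
      have "undominated ?A \<subset> ?U" using v(1) by (auto simp: undominated_insert)
      then have "card (undominated ?A) < card ?U"
        by (intro psubset_card_mono) (auto simp: undominated_def)
      from less.hyps[OF this A2]
      have "4 * int (game_value G Dominator ?A) \<le> 4 * int (card ?A) + potential (undominated ?A)" .
      moreover have "decrease ?U v + decrease (undominated (insert v A)) u \<ge> 8"
        using reply[of u] u(1) by (simp add: legal_moves_iff undominated_insert)
      moreover have "decrease (undominated (insert v A)) u
          = potential (undominated (insert v A)) - potential (undominated ?A)"
        by (simp add: decrease_def undominated_insert[of u])
      ultimately show ?thesis
        using le u(2) dv card_insert[of v A] card_insert[of u "insert v A"] by linarith
    qed
  qed
qed

end

theorem theorem1p2: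
  fixes G :: "('a,'b) pre_digraph"
  assumes "graph G"
    and "\<not> (\<exists>v. isolated_vertex G v)"
    and "\<not> (\<exists>C \<in> pre_digraph.sccs G. complete_digraph 2 C)"
  shows "real (game_total_domination_number G) \<le> 3 / 4 * real (card (verts G))"
proof -
  interpret isolate_free_graph G
    using assms by (simp add: isolate_free_graph_def isolate_free_graph_axioms_def)
  have "{v. w \<rightarrow>\<^bsub>G\<^esub> v} \<noteq> {x}" if "{v. x \<rightarrow>\<^bsub>G\<^esub> v} = {w}" for x w
    using isolated_edge_in_sccs[OF that] assms(3) by blast
  then have "potential (verts G) \<le> 3 * int (card (verts G))" by (rule potential_V)
  moreover have "undominated {} = verts G"
    by (simp add: undominated_def totally_dominated_def)
  ultimately have "4 * int (game_value G Dominator {}) \<le> 3 * int (card (verts G))"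
    using game_value_le_potential[of "{}"] by simp
  then show ?thesis by (simp add: game_total_domination_number_def)
qed

end
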